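(* Let $\Gamma,\varepsilon,c,a>0$, let $\theta\in\mathbb{R}$, and let $\varphi:\mathbb{R}\to\mathbb{R}$ be a smooth function. Consider the closed-loop system with state $(y,z)\in\mathbb{R}^2$ and input (disturbance) $d\in\mathbb{R}$: $$\dot y=\theta y\varphi(y)-\frac{c}{2}y-\frac{1+e^{z}}{2}\left(\frac{1+\varphi^2(y)y^2}{2a}+c+\frac{\varphi^2(y)}{c}\right)y+d,\qquad \dot z=\Gamma e^{-z}\left(\frac12y^2-\varepsilon\right)^{+},$$ with output $\tilde y=\left(|y|-\sqrt{2\varepsilon}\right)^{+}$. If there exists $\lambda\in(0,1)$ such that $$2\theta\varphi(y)\le(1+\lambda)c+\frac{cy^2+2a}{2ac}\varphi^2(y)+\frac{2c(1-\lambda)\varepsilon}{y^2}\qquad\text{for all }y\in\mathbb{R}\text{ with }|y|\ge\sqrt{2\varepsilon},$$ then this system with output $\tilde y$ satisfies the IOS property.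
   Context: Notation: $(s)^{+}:=\max\{0,s\}$ for $s\in\mathbb{R}$. The system arises from the plant $\dot y=\theta y\varphi(y)+u+d$ in closed loop with the adaptive feedback $u=-\frac c2y-\frac{1+e^z}{2}\left(\frac{1+\varphi^2(y)y^2}{2a}+c+\frac{\varphi^2(y)}{c}\right)y$, $\dot z=\Gamma e^{-z}\left(\frac12y^2-\varepsilon\right)^+$. Inputs are measurable locally essentially bounded functions $d:\mathbb{R}_{\ge0}\to\mathbb{R}$, and the closed-loop system is forward complete (solutions exist for all $t\ge0$, for every initial state and every such input). $\|d\|_\infty=\mathrm{ess\,sup}_{t\ge0}|d(t)|$. $\mathcal{KL}$: $\beta:\mathbb{R}_{\ge0}\times\mathbb{R}_{\ge0}\to\mathbb{R}_{\ge0}$ is of class $\mathcal{KL}$ if, for each fixed $t\ge0$, $\beta(\cdot,t)$ is continuous, strictly increasing and zero at zero and, for each fixed $s\ge0$, $\beta(s,\cdot)$ is continuous, non-increasing and tends to $0$ at infinity. IOS (input-to-output stability) with output $\tilde y$: there exist $\beta\in\mathcal{KL}$ and a continuous non-decreasing $\gamma:\mathbb{R}_{\ge0}\to\mathbb{R}_{\ge0}$ with $\gamma(0)=0$ such that, for every initial state $x_0=(y(0),z(0))\in\mathbb{R}^2$ and every measurable essentially bounded $d:\mathbb{R}_{\ge0}\to\mathbb{R}$, the output along the corresponding solution satisfies $|\tilde y(t)|\le\beta(|x_0|,t)+\gamma(\|d\|_\infty)$ for all $t\ge0$. The functions $\beta,\gamma$ may depend on $\theta,\varphi,\Gamma,\varepsilon,c,a$.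 *)

theory Defs
  imports "HOL-Analysis.Analysis" "HOL-Probability.Essential_Supremum"
begin

definition smooth_real :: "(real \<Rightarrow> real) \<Rightarrow> bool" where
  "smooth_real f \<longleftrightarrow> (\<forall>n x. (deriv ^^ n) f differentiable (at x))"

definition pos_part :: "real \<Rightarrow> real" where
  "pos_part s = max 0 s"

text \<open>Inputs are functions on \<open>[0, \<infinity>)\<close>; they are represented by total functions whose values
  at negative times are irrelevant. Measurability is Lebesgue measurability.\<close>

definition ess_norm :: "(real \<Rightarrow> real) \<Rightarrow> ereal" where
  "ess_norm d = esssup (lebesgue_on {0..}) (\<lambda>t. ereal \<bar>d t\<bar>)"

definition ess_bounded_input :: "(real \<Rightarrow> real) \<Rightarrow> bool" where
  "ess_bounded_input d \<longleftrightarrow> d \<in> borel_measurable (lebesgue_on {0..}) \<and> ess_norm d < \<infinity>"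

text \<open>Solution on \<open>[0, \<infinity>)\<close> of \<open>x' = f(x, d)\<close> in the sense of Caratheodory: the integral equation says
  precisely that \<open>x\<close> is locally absolutely continuous and satisfies the differential equation
  almost everywhere.\<close>

definition ode_solution ::
  "('s::euclidean_space \<Rightarrow> real \<Rightarrow> 's) \<Rightarrow> (real \<Rightarrow> real) \<Rightarrow> (real \<Rightarrow> 's) \<Rightarrow> bool" where
  "ode_solution f d x \<longleftrightarrow>
     (\<forall>t\<ge>0. set_integrable lebesgue {0..t} (\<lambda>s. f (x s) (d s)) \<and>
            x t = x 0 + set_lebesgue_integral lebesgue {0..t} (\<lambda>s. f (x s) (d s)))"

text \<open>For comparison functions only the values at nonnegative arguments matter. That these values
  are nonnegative follows from monotonicity and the value at zero, for the class \<open>KL\<close> and for the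
  gain \<open>\<gamma>\<close> below alike.\<close>

definition class_KL :: "(real \<Rightarrow> real \<Rightarrow> real) \<Rightarrow> bool" where
  "class_KL \<beta> \<longleftrightarrow>
     (\<forall>t\<ge>0. continuous_on {0..} (\<lambda>s. \<beta> s t) \<and> strict_mono_on {0..} (\<lambda>s. \<beta> s t) \<and> \<beta> 0 t = 0) \<and>
     (\<forall>s\<ge>0. continuous_on {0..} (\<beta> s) \<and> antimono_on {0..} (\<beta> s) \<and> (\<beta> s \<longlongrightarrow> 0) at_top)"

definition IOS :: "('s::euclidean_space \<Rightarrow> real \<Rightarrow> 's) \<Rightarrow> ('s \<Rightarrow> real) \<Rightarrow> bool" where
  "IOS f h \<longleftrightarrow>
     (\<exists>\<beta> \<gamma>. class_KL \<beta> \<and> continuous_on {0..} \<gamma> \<and> mono_on {0..} \<gamma> \<and> \<gamma> 0 = 0 \<and>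
        (\<forall>d x. ess_bounded_input d \<and> ode_solution f d x \<longrightarrow>
           (\<forall>t\<ge>0. \<bar>h (x t)\<bar> \<le> \<beta> (norm (x 0)) t + \<gamma> (real_of_ereal (ess_norm d)))))"

definition closed_loop ::
  "real \<Rightarrow> (real \<Rightarrow> real) \<Rightarrow> real \<Rightarrow> real \<Rightarrow> real \<Rightarrow> real \<Rightarrow> real \<times> real \<Rightarrow> real \<Rightarrow> real \<times> real" where
  "closed_loop \<theta> \<phi> \<Gamma> \<epsilon> c a = (\<lambda>(y, z) d.
     (\<theta> * y * \<phi> y - c / 2 * y
        - (1 + exp z) / 2 * ((1 + (\<phi> y)\<^sup>2 * y\<^sup>2) / (2 * a) + c + (\<phi> y)\<^sup>2 / c) * y + d,
      \<Gamma> * exp (- z) * pos_part (1 / 2 * y\<^sup>2 - \<epsilon>)))"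

definition deadzone_output :: "real \<Rightarrow> real \<times> real \<Rightarrow> real" where
  "deadzone_output \<epsilon> = (\<lambda>(y, z). pos_part (\<bar>y\<bar> - sqrt (2 * \<epsilon>)))"

end

theory Submission
  imports Defs
begin

text \<open>The term with \<open>e\<^sup>z > 0\<close> only adds damping and is dropped. Put \<open>k = c (1 - \<mu>)\<close>, and let \<open>D\<close> be the
  essential bound of the input. The hypothesis and \<open>y d \<le> y\<^sup>2 / (4 a) + a d\<^sup>2\<close> yield
  \<open>(y\<^sup>2 / 2)' \<le> - k (y\<^sup>2 / 2 - \<epsilon>) + a D\<^sup>2\<close> wherever \<open>y\<^sup>2 \<ge> 2 \<epsilon>\<close>, which gives
  \<open>y t ^ 2 \<le> y 0 ^ 2 exp (- k t) + 2 a D\<^sup>2 / k + 2 \<epsilon>\<close>; taking square roots separates the three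
  summands. Solutions being differentiable only almost everywhere, \<open>\<bar>y\<bar>\<close> itself is compared, in
  integral form, with the square root of the right-hand side.\<close>

text \<open>If \<open>w\<close> exceeded \<open>p\<close> at time \<open>t\<close>, then after the
  last earlier time \<open>t0\<close> with \<open>w t0 \<le> p t0\<close> it would stay strictly
  above \<open>p\<close>. There \<open>g \<le> p'\<close> almost everywhere, and integrating over
  \<open>{t0..t}\<close> lets \<open>w\<close> grow no more than \<open>p\<close>, a contradiction.
  The inequality between the slopes is thus only ever used where \<open>w\<close> is above
  \<open>p\<close>.\<close>

lemma caratheodory_comparison:
  fixes w g p p' :: "real \<Rightarrow> real"
  assumes int: "\<And>t. 0 \<le> t \<Longrightarrow> set_integrable lebesgue {0..t} g"
    and w: "\<And>t. 0 \<le> t \<Longrightarrow> w t = w 0 + (LINT s:{0..t}|lebesgue. g s)"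
    and p: "\<And>t. 0 \<le> t \<Longrightarrow> (p has_real_derivative p' t) (at t)"
    and p': "continuous_on {0..} p'"
    and init: "w 0 \<le> p 0"
    and le: "AE s in lebesgue. 0 \<le> s \<longrightarrow> p s < w s \<longrightarrow> g s \<le> p' s"
    and "0 \<le> t"
  shows "w t \<le> p t"
proof (rule ccontr)
  assume "\<not> w t \<le> p t"
  note HK = set_lebesgue_integral_eq_integral[OF int]
  have cont_w: "continuous_on {0..t} w"
  proof (rule continuous_on_eq)
    show "continuous_on {0..t} (\<lambda>s. w 0 + integral {0..s} g)"
      by (intro continuous_intros indefinite_integral_continuous_1 HK \<open>0 \<le> t\<close>)
    show "w 0 + integral {0..s} g = w s" if "s \<in> {0..t}" for s
      using that w[of s] HK(2)[of s] by simp
  qed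
  have cont_p: "continuous_on {0..t} p"
    using p by (intro continuous_at_imp_continuous_on ballI) (auto intro: DERIV_isCont)
  \<comment> \<open>Continuity of \<open>w\<close> and \<open>p\<close> makes \<open>S\<close>
    closed, so its supremum is attained and is the last crossing time.\<close>
  define S where "S = {s \<in> {0..t}. w s \<le> p s}"
  define t0 where "t0 = Sup S"
  have "closed S"
    unfolding S_def by (rule continuous_on_closed_Collect_le[OF cont_w cont_p]) simp
  moreover have "S \<noteq> {}" "bdd_above S"
    using init \<open>0 \<le> t\<close> unfolding S_def by (auto intro!: bdd_aboveI[of _ t])
  ultimately have "t0 \<in> S"
    unfolding t0_def by (intro closed_contains_Sup)
  then have t0: "0 \<le> t0" "t0 \<le> t" "w t0 \<le> p t0"
    by (auto simp: S_def)
  have above: "p s < w s" if "t0 < s" "s \<le> t" for s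
    using that cSup_upper[OF _ \<open>bdd_above S\<close>, of s] t0 unfolding t0_def[symmetric]
    by (force simp: S_def not_le)
  have int': "set_integrable lebesgue {t0..t} g"
    using int[OF \<open>0 \<le> t\<close>] t0 by (rule_tac set_integrable_subset) auto
  have "w t - w t0 = (LINT s:{t0..t}|lebesgue. g s)"
    using w[of t] w[of t0] t0 \<open>0 \<le> t\<close> HK(2)[of t] HK(2)[of t0]
      Henstock_Kurzweil_Integration.integral_combine[of 0 t0 t g, OF _ _ HK(1)]
      set_lebesgue_integral_eq_integral(2)[OF int']
    by simp
  also have "\<dots> \<le> (LINT s:{t0..t}|lebesgue. p' s)"
  proof (rule set_integral_mono_AE[OF int'])
    show "set_integrable lebesgue {t0..t} p'"
      using t0 by (intro absolutely_integrable_continuous_real continuous_on_subset[OF p']) auto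
    \<comment> \<open>At \<open>t0\<close> itself the strict inequality fails; this endpoint is
      discarded as a null set.\<close>
    have "AE s in lebesgue. s \<noteq> t0"
      by (intro AE_completion AE_lborel_singleton)
    with le show "AE s\<in>{t0..t} in lebesgue. g s \<le> p' s"
    proof eventually_elim
      case (elim s)
      then show ?case using above[of s] t0 by auto
    qed
  qed
  also have "\<dots> = integral {t0..t} p'"
    using t0 by (intro set_lebesgue_integral_eq_integral absolutely_integrable_continuous_real
        continuous_on_subset[OF p']) auto
  also have "\<dots> = p t - p t0"
    using t0 p by (intro integral_unique fundamental_theorem_of_calculus)
      (auto simp flip: has_real_derivative_iff_has_vector_derivative
        intro: has_field_derivative_at_within)
  finally show False
    using \<open>\<not> w t \<le> p t\<close> t0 by simp
qed

lemma ess_norm_AE: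
  assumes "ess_bounded_input d"
  shows "AE t in lebesgue. 0 \<le> t \<longrightarrow> \<bar>d t\<bar> \<le> real_of_ereal (ess_norm d)"
proof -
  have "AE t in lebesgue_on {0..}. ereal \<bar>d t\<bar> \<le> ess_norm d"
    unfolding ess_norm_def by (rule esssup_AE)
  then have "AE t in lebesgue. t \<in> {0..} \<longrightarrow> ereal \<bar>d t\<bar> \<le> ess_norm d"
    by (subst (asm) AE_restrict_space_iff) auto
  then show ?thesis
  proof eventually_elim
    case (elim t)
    \<comment> \<open>\<open>real_of_ereal\<close> sends both infinities to 0: \<infinity> is
      excluded by essential boundedness, -\<infinity> by the real lower bound
      \<open>\<bar>d t\<bar>\<close>.\<close>
    then show ?case
      using assms unfolding ess_bounded_input_def
      by (cases "ess_norm d") auto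
  qed
qed

text \<open>Multiplied by \<open>y\<^sup>2 / 2\<close>, the hypothesis on \<phi> matches the damping
  of the feedback term by term. What remains is the decay towards \<epsilon> and the surplus
  \<open>- y\<^sup>2 / (4 * a)\<close>, kept to absorb the disturbance later.\<close>

lemma closed_loop_drift_le:
  fixes \<Gamma> \<epsilon> c a \<theta> \<mu> y :: real
  assumes "\<epsilon> > 0" and "c > 0" and "a > 0" and y: "\<bar>y\<bar> \<ge> sqrt (2 * \<epsilon>)"
    and bound: "2 * \<theta> * \<phi> y \<le> (1 + \<mu>) * c + (c * y\<^sup>2 + 2 * a) / (2 * a * c) * (\<phi> y)\<^sup>2
                              + 2 * c * (1 - \<mu>) * \<epsilon> / y\<^sup>2"
  shows "y * fst (closed_loop \<theta> \<phi> \<Gamma> \<epsilon> c a (y, z) d)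
           \<le> - (c * (1 - \<mu>)) * (y\<^sup>2 / 2 - \<epsilon>) - y\<^sup>2 / (4 * a) + y * d"
proof -
  have "0 < sqrt (2 * \<epsilon>)" using assms by simp
  with y have "y \<noteq> 0" by force
  then have y2: "y * y \<noteq> 0" by (simp add: power2_eq_square)
  define Q where "Q = (1 + (\<phi> y)\<^sup>2 * y\<^sup>2) / (2 * a) + c + (\<phi> y)\<^sup>2 / c"
  have "0 \<le> exp z / 2 * Q * y\<^sup>2"
    using assms by (simp add: Q_def)
  moreover have "2 * \<theta> * \<phi> y * (y\<^sup>2 / 2)
      \<le> ((1 + \<mu>) * c + (c * y\<^sup>2 + 2 * a) / (2 * a * c) * (\<phi> y)\<^sup>2
                              + 2 * c * (1 - \<mu>) * \<epsilon> / y\<^sup>2) * (y\<^sup>2 / 2)"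
    using bound by (rule mult_right_mono) simp
  moreover have "((1 + \<mu>) * c + (c * y\<^sup>2 + 2 * a) / (2 * a * c) * (\<phi> y)\<^sup>2
                              + 2 * c * (1 - \<mu>) * \<epsilon> / y\<^sup>2) * (y\<^sup>2 / 2)
      = c / 2 * y\<^sup>2 + Q * y\<^sup>2 / 2 - y\<^sup>2 / (4 * a) - c * (1 - \<mu>) * (y\<^sup>2 / 2 - \<epsilon>)"
    using assms y2 unfolding Q_def by (simp add: field_simps power2_eq_square)
  moreover have "y * fst (closed_loop \<theta> \<phi> \<Gamma> \<epsilon> c a (y, z) d)
      = 2 * \<theta> * \<phi> y * (y\<^sup>2 / 2) - c / 2 * y\<^sup>2 - Q * y\<^sup>2 / 2 - exp z / 2 * Q * y\<^sup>2 + y * d"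
  proof -
    have "fst (closed_loop \<theta> \<phi> \<Gamma> \<epsilon> c a (y, z) d)
        = \<theta> * y * \<phi> y - c / 2 * y - (1 + exp z) / 2 * Q * y + d"
      by (simp add: closed_loop_def Q_def)
    then show ?thesis
      unfolding power2_eq_square by (simp only:) (simp add: algebra_simps)
  qed
  ultimately show ?thesis
    unfolding mult_minus_left by linarith
qed

text \<open>The bound on \<open>v'\<close> coming from \<open>closed_loop_drift_le\<close>, divided by \<open>v = \<bar>y\<bar>\<close>, is decreasing in
  \<open>v\<close>, so it may be evaluated at the smaller value \<open>p\<close> of the comparison function.\<close>
lemma drift_le_at_barrier:
  fixes k a \<epsilon> D v p F \<delta> :: real
  assumes "k > 0" "a > 0" "\<epsilon> > 0" "0 < p" "p \<le> v" "\<bar>\<delta>\<bar> \<le> D"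
    and F: "v * F \<le> - k * (v\<^sup>2 / 2 - \<epsilon>) - v\<^sup>2 / (4 * a) + v * \<delta>"
  shows "F \<le> (- k * (p\<^sup>2 / 2 - \<epsilon>) + a * D\<^sup>2) / p"
proof -
  have v: "0 < v" using assms by simp
  have "F \<le> (- k * (v\<^sup>2 / 2 - \<epsilon>) - v\<^sup>2 / (4 * a) + v * \<delta>) / v"
    using F v by (simp add: pos_le_divide_eq mult.commute)
  also have "\<dots> = - (k * v / 2) + k * \<epsilon> / v - v / (4 * a) + \<delta>"
    using v \<open>a > 0\<close> by (simp add: field_simps power2_eq_square)
  also have "\<dots> \<le> - (k * p / 2) + k * \<epsilon> / p - p / (4 * a) + D"
  proof -
    have "k * p / 2 \<le> k * v / 2" "p / (4 * a) \<le> v / (4 * a)" "k * \<epsilon> / v \<le> k * \<epsilon> / p"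
      using assms by (auto intro!: divide_right_mono divide_left_mono mult_left_mono)
    then show ?thesis using assms by linarith
  qed
  also have "\<dots> = (- k * (p\<^sup>2 / 2 - \<epsilon>) - p\<^sup>2 / (4 * a) + p * D) / p"
    using \<open>0 < p\<close> \<open>a > 0\<close> by (simp add: field_simps power2_eq_square)
  also have "\<dots> \<le> (- k * (p\<^sup>2 / 2 - \<epsilon>) + a * D\<^sup>2) / p"
  proof -
    \<comment> \<open>Completing the square: the surplus \<open>p\<^sup>2 / (4 * a)\<close> pays for
      \<open>p * D\<close> up to \<open>a * D\<^sup>2\<close>.\<close>
    have "0 \<le> (p - 2 * a * D)\<^sup>2 / (4 * a)"
      using \<open>a > 0\<close> by simp
    also have "\<dots> = p\<^sup>2 / (4 * a) - p * D + a * D\<^sup>2"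
      using \<open>a > 0\<close> by (simp add: field_simps power2_eq_square)
    finally show ?thesis
      using \<open>0 < p\<close> by (intro divide_right_mono) auto
  qed
  finally show ?thesis .
qed

text \<open>The radicand \<open>q\<close> solves
  \<open>(q / 2)' = - k * (q / 2 - \<epsilon>) + a * D\<^sup>2\<close> exactly and starts above
  \<open>Y\<^sup>2\<close>, so \<open>sqrt q\<close> serves as the barrier. The summand
  \<open>2 * \<epsilon>\<close> keeps \<open>q\<close> positive, hence \<open>sqrt q\<close>
  differentiable, even for \<open>Y = D = 0\<close>.\<close>

lemma barrier_bound:
  fixes k a \<epsilon> Y D t :: real and w g \<delta> :: "real \<Rightarrow> real"
  assumes "k > 0" "a > 0" "\<epsilon> > 0"
    and int: "\<And>t. 0 \<le> t \<Longrightarrow> set_integrable lebesgue {0..t} g"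
    and w: "\<And>t. 0 \<le> t \<Longrightarrow> w t = w 0 + (LINT s:{0..t}|lebesgue. g s)"
    and \<delta>: "AE s in lebesgue. 0 \<le> s \<longrightarrow> \<bar>\<delta> s\<bar> \<le> D"
    and g: "\<And>s. 0 \<le> s \<Longrightarrow> sqrt (2 * \<epsilon>) \<le> w s \<Longrightarrow>
      w s * g s \<le> - k * ((w s)\<^sup>2 / 2 - \<epsilon>) - (w s)\<^sup>2 / (4 * a) + w s * \<delta> s"
    and init: "w 0 \<le> Y" and "0 \<le> t"
  shows "w t \<le> sqrt (Y\<^sup>2 * exp (- k * t) + 2 * a * D\<^sup>2 / k + 2 * \<epsilon>)"
proof -
  define q where "q s = Y\<^sup>2 * exp (- k * s) + 2 * a * D\<^sup>2 / k + 2 * \<epsilon>" for s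
  define p' where "p' s = - k * Y\<^sup>2 * exp (- k * s) / 2 / sqrt (q s)" for s
  have D: "0 \<le> 2 * a * D\<^sup>2 / k"
    using \<open>k > 0\<close> \<open>a > 0\<close> by simp
  have q: "2 * \<epsilon> \<le> q s" for s
    unfolding q_def using D by simp
  then have q_pos: "0 < q s" for s
    using \<open>\<epsilon> > 0\<close> by (smt (verit))
  have "w t \<le> sqrt (q t)"
  proof (rule caratheodory_comparison[where p = "\<lambda>s. sqrt (q s)" and p' = p', OF int w])
    show "((\<lambda>s. sqrt (q s)) has_real_derivative p' s) (at s)" for s
    proof -
      have "(q has_real_derivative - k * Y\<^sup>2 * exp (- k * s)) (at s)"
        unfolding q_def by (auto intro!: derivative_eq_intros)
      from DERIV_chain2[OF DERIV_real_sqrt[OF q_pos] this] show ?thesis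
        by (simp add: p'_def field_simps)
    qed
    show "continuous_on {0..} p'"
    proof -
      have "continuous_on {0..} q"
        unfolding q_def by (intro continuous_intros)
      moreover have "q s \<noteq> 0" for s
        using q_pos[of s] by simp
      ultimately show ?thesis
        unfolding p'_def by (intro continuous_intros) auto
    qed
    have "Y\<^sup>2 \<le> q 0"
      unfolding q_def using D \<open>\<epsilon> > 0\<close> by simp
    then show "w 0 \<le> sqrt (q 0)"
      using init by (meson abs_ge_self order_trans real_le_rsqrt real_sqrt_le_mono)
    show "AE s in lebesgue. 0 \<le> s \<longrightarrow> sqrt (q s) < w s \<longrightarrow> g s \<le> p' s"
      using \<delta>
    proof eventually_elim
      case (elim s)
      show ?case
      proof (intro impI)
        assume s: "0 \<le> s" and lt: "sqrt (q s) < w s"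
        \<comment> \<open>The barrier never drops below the threshold, so the drift estimate is
          available wherever \<open>w\<close> exceeds the barrier.\<close>
        have "sqrt (2 * \<epsilon>) \<le> w s"
          using lt q[of s] real_sqrt_le_mono by (meson less_imp_le order_trans)
        then have "g s \<le> (- k * ((sqrt (q s))\<^sup>2 / 2 - \<epsilon>) + a * D\<^sup>2) / sqrt (q s)"
          using elim s lt q_pos[of s] g[OF s]
          by (intro drift_le_at_barrier[OF \<open>k > 0\<close> \<open>a > 0\<close> \<open>\<epsilon> > 0\<close>]) auto
        also have "- k * ((sqrt (q s))\<^sup>2 / 2 - \<epsilon>) + a * D\<^sup>2 = - k * Y\<^sup>2 * exp (- k * s) / 2"
          using q_pos[of s] \<open>k > 0\<close> by (simp add: q_def field_simps)
        finally show "g s \<le> p' s"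
          unfolding p'_def .
      qed
    qed
  qed (use \<open>0 \<le> t\<close> in auto)
  then show ?thesis
    by (simp add: q_def)
qed

lemma class_KL_mult_exp:
  assumes "k > 0"
  shows "class_KL (\<lambda>s t. s * exp (- k * t))"
proof -
  have "((\<lambda>t. s * exp (- k * t)) \<longlongrightarrow> s * 0) at_top" for s
    using assms
    by (intro tendsto_mult tendsto_const filterlim_compose[OF exp_at_bot]
        filterlim_tendsto_neg_mult_at_bot[where c = "- k"] filterlim_ident) auto
  then show ?thesis
    using assms unfolding class_KL_def
    by (auto intro!: continuous_intros strict_mono_onI monotone_onI mult_left_mono)
qed

text \<open>Square roots are subadditive, and the output subtracts precisely the resulting
  \<open>sqrt (2 * \<epsilon>)\<close>.\<close>

lemma deadzone_output_le:
  fixes A B \<epsilon> y :: real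
  assumes "\<bar>y\<bar> \<le> sqrt (A\<^sup>2 + B\<^sup>2 + 2 * \<epsilon>)" "0 \<le> A" "0 \<le> B" "0 \<le> \<epsilon>"
  shows "\<bar>deadzone_output \<epsilon> (y, z)\<bar> \<le> A + B"
proof -
  have "sqrt (A\<^sup>2 + B\<^sup>2 + 2 * \<epsilon>) \<le> sqrt (A\<^sup>2) + sqrt (B\<^sup>2) + sqrt (2 * \<epsilon>)"
    using sqrt_add_le_add_sqrt[of "A\<^sup>2 + B\<^sup>2" "2 * \<epsilon>"] sqrt_add_le_add_sqrt[of "A\<^sup>2" "B\<^sup>2"]
      assms by simp
  then show ?thesis
    using assms by (auto simp: deadzone_output_def pos_part_def)
qed

theorem proposition8:
  fixes \<Gamma> \<epsilon> c a \<theta> :: real and \<phi> :: "real \<Rightarrow> real"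
  assumes "\<Gamma> > 0" and "\<epsilon> > 0" and "c > 0" and "a > 0"
    and "smooth_real \<phi>"
    and "\<exists>\<mu>. 0 < \<mu> \<and> \<mu> < 1 \<and>
           (\<forall>y. \<bar>y\<bar> \<ge> sqrt (2 * \<epsilon>) \<longrightarrow>
              2 * \<theta> * \<phi> y \<le> (1 + \<mu>) * c + (c * y\<^sup>2 + 2 * a) / (2 * a * c) * (\<phi> y)\<^sup>2
                              + 2 * c * (1 - \<mu>) * \<epsilon> / y\<^sup>2)"
  shows "IOS (closed_loop \<theta> \<phi> \<Gamma> \<epsilon> c a) (deadzone_output \<epsilon>)"
proof -
  obtain \<mu> where "\<mu> < 1" and bound: "\<And>y. \<bar>y\<bar> \<ge> sqrt (2 * \<epsilon>) \<Longrightarrow>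
      2 * \<theta> * \<phi> y \<le> (1 + \<mu>) * c + (c * y\<^sup>2 + 2 * a) / (2 * a * c) * (\<phi> y)\<^sup>2
                      + 2 * c * (1 - \<mu>) * \<epsilon> / y\<^sup>2"
    using assms(6) by blast
  let ?f = "closed_loop \<theta> \<phi> \<Gamma> \<epsilon> c a"
  define k where "k = c * (1 - \<mu>)"
  have "k > 0"
    using \<open>\<mu> < 1\<close> \<open>c > 0\<close> by (simp add: k_def)
  \<comment> \<open>The square root of the summand \<open>2 * a * D\<^sup>2 / k\<close>. The
    absolute value makes it nonnegative without a sign condition on \<open>D\<close>.\<close>
  define \<gamma> where "\<gamma> r = sqrt (2 * a / k) * \<bar>r\<bar>" for r
  have "\<bar>deadzone_output \<epsilon> (x t)\<bar>
      \<le> norm (x 0) * exp (- (k / 2) * t) + \<gamma> (real_of_ereal (ess_norm d))"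
    if d: "ess_bounded_input d" and x: "ode_solution ?f d x" and "0 \<le> t" for d x t
  proof -
    define D where "D = real_of_ereal (ess_norm d)"
    define y where "y s = fst (x s)" for s
    define g where "g s = fst (?f (x s) (d s))" for s
    have I: "set_integrable lebesgue {0..t} (\<lambda>s. ?f (x s) (d s))"
      and x_eq: "x t = x 0 + (LINT s:{0..t}|lebesgue. ?f (x s) (d s))" if "0 \<le> t" for t
      using x that unfolding ode_solution_def by blast+
    \<comment> \<open>Only the first component of the integral equation is followed;
      \<open>z\<close> enters through the drift bound, which is uniform in it.\<close>
    have int: "set_integrable lebesgue {0..t} g" if "0 \<le> t" for t
      using absolutely_integrable_linear[OF I[OF that] bounded_linear_fst]
      unfolding g_def o_def .
    have y_eq: "y t = y 0 + (LINT s:{0..t}|lebesgue. g s)" if "0 \<le> t" for t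
      using integral_linear[OF set_lebesgue_integral_eq_integral(1)[OF I[OF that]] bounded_linear_fst]
        set_lebesgue_integral_eq_integral(2)[OF I[OF that]]
        set_lebesgue_integral_eq_integral(2)[OF int[OF that]] arg_cong[OF x_eq[OF that], of fst]
      unfolding y_def g_def o_def by simp
    have D: "AE s in lebesgue. 0 \<le> s \<longrightarrow> \<bar>d s\<bar> \<le> D"
      unfolding D_def using d by (rule ess_norm_AE)
    have drift: "y s * g s \<le> - k * ((y s)\<^sup>2 / 2 - \<epsilon>) - (y s)\<^sup>2 / (4 * a) + y s * d s"
      if "sqrt (2 * \<epsilon>) \<le> \<bar>y s\<bar>" for s
      using closed_loop_drift_le[where \<phi> = \<phi> and z = "snd (x s)" and d = "d s",
          OF \<open>\<epsilon> > 0\<close> \<open>c > 0\<close> \<open>a > 0\<close> that bound[OF that]]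
      by (simp add: y_def g_def k_def)
    \<comment> \<open>The barrier starts from the norm of the whole initial state, which dominates
      \<open>\<bar>y 0\<bar>\<close> and is the quantity allowed in \<beta>.\<close>
    define R where "R = sqrt ((norm (x 0))\<^sup>2 * exp (- k * t) + 2 * a * D\<^sup>2 / k + 2 * \<epsilon>)"
    have init: "\<bar>y 0\<bar> \<le> norm (x 0)"
      unfolding y_def using norm_fst_le[of "fst (x 0)" "snd (x 0)"] by simp
    have "y t \<le> R"
      unfolding R_def
      by (rule barrier_bound[OF \<open>k > 0\<close> \<open>a > 0\<close> \<open>\<epsilon> > 0\<close> int y_eq D])
        (use init drift \<open>0 \<le> t\<close> in auto)
    \<comment> \<open>The drift bound is invariant under changing the signs of \<open>y\<close>,
      \<open>g\<close> and \<open>d\<close> together, so the same barrier bounds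
      \<open>- y\<close>.\<close>
    moreover have "- y t \<le> R"
      unfolding R_def
    proof (rule barrier_bound[where g = "\<lambda>s. - g s" and \<delta> = "\<lambda>s. - d s",
          OF \<open>k > 0\<close> \<open>a > 0\<close> \<open>\<epsilon> > 0\<close>])
      show "set_integrable lebesgue {0..t} (\<lambda>s. - g s)" if "0 \<le> t" for t
        using int[OF that] by (simp add: set_integrable_def)
      show "- y t = - y 0 + (LINT s:{0..t}|lebesgue. - g s)" if "0 \<le> t" for t
        using y_eq[OF that] by (simp add: set_lebesgue_integral_def)
    qed (use init drift D \<open>0 \<le> t\<close> in auto)
    ultimately have "\<bar>y t\<bar> \<le> R"
      by simp
    \<comment> \<open>Writing the decaying summand as a square halves the rate, whence
      \<open>k / 2\<close> in \<beta>.\<close>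
    also have "R = sqrt ((norm (x 0) * exp (- (k / 2) * t))\<^sup>2 + (\<gamma> D)\<^sup>2 + 2 * \<epsilon>)"
      using \<open>k > 0\<close> \<open>a > 0\<close>
      by (simp add: R_def \<gamma>_def power_mult_distrib flip: exp_of_nat_mult exp_double)
    finally have "\<bar>deadzone_output \<epsilon> (y t, snd (x t))\<bar>
        \<le> norm (x 0) * exp (- (k / 2) * t) + \<gamma> D"
      by (rule deadzone_output_le) (use \<open>k > 0\<close> \<open>a > 0\<close> \<open>\<epsilon> > 0\<close> in \<open>auto simp: \<gamma>_def\<close>)
    then show ?thesis
      by (simp add: y_def D_def)
  qed
  moreover have "continuous_on {0..} \<gamma>" "mono_on {0..} \<gamma>" "\<gamma> 0 = 0"
    using \<open>k > 0\<close> \<open>a > 0\<close> unfolding \<gamma>_def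
    by (auto intro!: continuous_intros monotone_onI mult_left_mono)
  moreover have "class_KL (\<lambda>s t. s * exp (- (k / 2) * t))"
    using class_KL_mult_exp[of "k / 2"] \<open>k > 0\<close> by simp
  ultimately show ?thesis
    unfolding IOS_def
    by (intro exI[of _ "\<lambda>s t. s * exp (- (k / 2) * t)"] exI[of _ \<gamma>]) auto
qed

end
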